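(* Newton's method is globally conservative if the initial guess has correct mass: let $\hat{\mathbf f}:\mathbb R^m\to\mathbb R^m$ be a differentiable globally conservative discretization with cell volumes $|\Omega_1|,\dots,|\Omega_m|$ and Jacobian $\hat{\mathbf f}'$, let $\alpha\in\mathbb R$, $\mathbf u^n\in\mathbb R^m$, and let the iterates $\mathbf u^{(k)}$ satisfy, for $k=0,1,\dots$, $$\left(\mathbf I-\alpha\hat{\mathbf f}'(\mathbf u^{(k)})\right)\Delta\mathbf u^{(k)}=\mathbf u^n-\mathbf u^{(k)}+\alpha\hat{\mathbf f}(\mathbf u^{(k)}),\qquad \mathbf u^{(k+1)}=\mathbf u^{(k)}+\Delta\mathbf u^{(k)}.$$ If $\sum_{i=1}^m|\Omega_i|u_i^{(0)}=\sum_{i=1}^m|\Omega_i|u_i^n$, then $$\sum_{i=1}^m|\Omega_i|u_i^{(k+1)}=\sum_{i=1}^m|\Omega_i|u_i^n,\qquad k=0,1,\dots$$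
   Context: $\hat{\mathbf f}=(\hat f_1,\dots,\hat f_m)^\top$ comes from a semidiscretization $\mathbf u_t=\hat{\mathbf f}(\mathbf u)$ on a mesh with cells $\Omega_i$ of volume $|\Omega_i|>0$; it is globally conservative if $\sum_{i=1}^m|\Omega_i|\hat f_i(\mathbf u)=0$ for all $\mathbf u\in\mathbb R^m$. The iteration above is Newton's method for the implicit Euler system $\mathbf u-\alpha\hat{\mathbf f}(\mathbf u)=\mathbf u^n$. An iterative method for this system is globally conservative if $\sum_i|\Omega_i|u_i^{(k+1)}=\sum_i|\Omega_i|u_i^n$ for $k=0,1,\dots$ *)

theory Defs
  imports "HOL-Analysis.Analysis"
begin

text \<open>
  The finite type \<open>'m\<close> indexes the mesh cells, and \<open>vol i\<close> is the volume
  \<open>|\<Omega>\<^sub>i|\<close> of cell \<open>i\<close>.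
\<close>

definition total_mass :: "('m::finite \<Rightarrow> real) \<Rightarrow> real ^ 'm \<Rightarrow> real" where
  "total_mass vol v = (\<Sum>i\<in>UNIV. vol i * v $ i)"

definition conservative_discretization ::
  "('m::finite \<Rightarrow> real) \<Rightarrow> (real ^ 'm \<Rightarrow> real ^ 'm) \<Rightarrow> bool" where
  "conservative_discretization vol f \<longleftrightarrow> (\<forall>u. total_mass vol (f u) = 0)"

definition conservative_iteration ::
  "('m::finite \<Rightarrow> real) \<Rightarrow> real ^ 'm \<Rightarrow> (nat \<Rightarrow> real ^ 'm) \<Rightarrow> bool" where
  "conservative_iteration vol un u \<longleftrightarrow> (\<forall>k. total_mass vol (u (Suc k)) = total_mass vol un)"

definition jacobian_matrix :: "(real ^ 'm \<Rightarrow> real ^ 'm) \<Rightarrow> real ^ 'm \<Rightarrow> real ^ 'm ^ 'm" where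
  "jacobian_matrix f x = matrix (frechet_derivative f (at x))"

text \<open>
  Newton's method for the implicit Euler system \<open>u - \<alpha> f(u) = un\<close>. The increment
  \<open>du k\<close> is any solution of the linear system; the system matrix is not required
  to be invertible.
\<close>

definition newton_iteration ::
  "(real ^ 'm \<Rightarrow> real ^ 'm) \<Rightarrow> real \<Rightarrow> real ^ 'm \<Rightarrow>
    (nat \<Rightarrow> real ^ 'm) \<Rightarrow> (nat \<Rightarrow> real ^ 'm) \<Rightarrow> bool" where
  "newton_iteration f \<alpha> un u du \<longleftrightarrow>
    (\<forall>k. (mat 1 - \<alpha> *\<^sub>R jacobian_matrix f (u k)) *v du k = un - u k + \<alpha> *\<^sub>R f (u k) \<and>
         u (Suc k) = u k + du k)"

end

theory Submission
  imports Defs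
begin

text \<open>
  The total mass is a linear functional, and conservativity says that it vanishes on the range
  of the discretization. Differentiating the constant \<open>total_mass vol \<circ> f\<close> shows that it also
  vanishes on the range of the Jacobian (lemma \<open>total_mass_jacobian_eq_0\<close>). Applied to the Newton
  system it therefore removes both terms that carry \<open>\<alpha>\<close>: the mass of the increment is the mass
  of \<open>un\<close> minus that of the current iterate, which is exactly what the update needs to
  restore the mass of \<open>un\<close>.
\<close>

lemma linear_total_mass: "linear (total_mass vol)"
  by (rule linearI)
    (simp_all add: total_mass_def algebra_simps sum.distrib sum_distrib_left)

lemma jacobian_matrix_vector_mult:
  fixes f :: "real ^ 'm \<Rightarrow> real ^ 'm"
  assumes "f differentiable (at x)"
  shows "jacobian_matrix f x *v v = frechet_derivative f (at x) v"
  using linear_frechet_derivative[OF assms]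
  by (simp add: jacobian_matrix_def matrix_works linear_matrix_vector_mul_eq)

text \<open>
  By the chain rule, the left-hand side is the derivative of \<open>total_mass vol \<circ> f\<close> at \<open>x\<close> in
  direction \<open>v\<close>, and this function is constant.
\<close>

lemma total_mass_jacobian_eq_0:
  assumes diff: "f differentiable (at x)"
    and cons: "conservative_discretization vol f"
  shows "total_mass vol (jacobian_matrix f x *v v) = 0"
proof -
  have "bounded_linear (total_mass vol)"
    using linear_total_mass linear_conv_bounded_linear by blast
  moreover have "(f has_derivative frechet_derivative f (at x)) (at x)"
    using diff frechet_derivative_works by blast
  ultimately have
    "((\<lambda>y. total_mass vol (f y)) has_derivative
      (\<lambda>w. total_mass vol (frechet_derivative f (at x) w))) (at x)"
    by (rule bounded_linear.has_derivative)
  moreover have "(\<lambda>y. total_mass vol (f y)) = (\<lambda>y. 0)"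
    using cons by (simp add: conservative_discretization_def)
  ultimately have "(\<lambda>w. total_mass vol (frechet_derivative f (at x) w)) = (\<lambda>w. 0)"
    using has_derivative_unique[OF _ has_derivative_const] by metis
  then show ?thesis
    unfolding jacobian_matrix_vector_mult[OF diff] by (rule fun_cong)
qed

theorem mainTheorem5:
  fixes f :: "real ^ 'm \<Rightarrow> real ^ 'm"
    and vol :: "'m::finite \<Rightarrow> real"
    and \<alpha> :: real
    and un :: "real ^ 'm"
    and u du :: "nat \<Rightarrow> real ^ 'm"
  assumes "\<And>i. vol i > 0"
    and "\<And>x. f differentiable (at x)"
    and "conservative_discretization vol f"
    and "newton_iteration f \<alpha> un u du"
    and "total_mass vol (u 0) = total_mass vol un"
  shows "conservative_iteration vol un u"
  unfolding conservative_iteration_def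
proof
  fix k
  let ?M = "total_mass vol" and ?J = "jacobian_matrix f (u k)"
  interpret M: linear ?M by (rule linear_total_mass)
  have "(mat 1 - \<alpha> *\<^sub>R ?J) *v du k = un - u k + \<alpha> *\<^sub>R f (u k)"
    and step: "u (Suc k) = u k + du k"
    using assms(4) by (simp_all add: newton_iteration_def)
  then have "du k - \<alpha> *\<^sub>R (?J *v du k) = un - u k + \<alpha> *\<^sub>R f (u k)"
    by (simp add: matrix_vector_mult_diff_rdistrib scaleR_matrix_vector_assoc)
  then have "?M (du k - \<alpha> *\<^sub>R (?J *v du k)) = ?M (un - u k + \<alpha> *\<^sub>R f (u k))"
    by simp
  then have "?M (du k) - \<alpha> * ?M (?J *v du k) = ?M un - ?M (u k) + \<alpha> * ?M (f (u k))"
    by (simp add: M.add M.diff M.scale)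
  moreover have "?M (?J *v du k) = 0"
    using assms(2,3) by (rule total_mass_jacobian_eq_0)
  moreover have "?M (f (u k)) = 0"
    using assms(3) by (simp add: conservative_discretization_def)
  ultimately show "?M (u (Suc k)) = ?M un"
    by (simp add: step M.add)
qed

end
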